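(* Let $M\ge 2$ and let $\mathbf{x}:\mathbb{Z}^2\to\mathbb{R}^{M+1}\setminus\{0\}$ be homogeneous coordinates of a Koenigs lattice satisfying $$\mathbf{x}_{(12)}+\mathbf{x}=F_{(1)}\mathbf{x}_{(1)}+F_{(2)}\mathbf{x}_{(2)}$$ for a function $F:\mathbb{Z}^2\to\mathbb{R}$. Let $\theta:\mathbb{Z}^2\to\mathbb{R}$ be a scalar solution of the (adjoint) Moutard equation $$\theta_{(12)}+\theta=F(\theta_{(1)}+\theta_{(2)}),$$ and put $$\phi=\theta_{(1)}+\theta_{(2)},\qquad \phi'=\frac{1}{\theta_{(1)}}+\frac{1}{\theta_{(2)}},$$ where $\theta$ and $\phi$ (hence $\phi'$) vanish nowhere. Then the solution $\mathbf{x}'$ of the linear system $$\Delta_1\left(\frac{\mathbf{x}'}{\phi'}\right)=(\theta\theta_{(2)})_{(1)}\,\Delta_1\left(\frac{\mathbf{x}}{\phi}\right),\qquad \Delta_2\left(\frac{\mathbf{x}'}{\phi'}\right)=-(\theta\theta_{(1)})_{(2)}\,\Delta_2\left(\frac{\mathbf{x}}{\phi}\right)$$ is a new Koenigs lattice, satisfying $$\mathbf{x}'_{(12)}+\mathbf{x}'=F'_{(1)}\mathbf{x}'_{(1)}+F'_{(2)}\mathbf{x}'_{(2)},\qquad F'=F\,\frac{\theta_{(1)}\theta_{(2)}}{\theta\,\theta_{(12)}}.$$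
   Context: Notation: for a function $g$ on $\mathbb{Z}^2$, $g_{(1)}(n_1,n_2)=g(n_1+1,n_2)$, $g_{(2)}(n_1,n_2)=g(n_1,n_2+1)$, $g_{(12)}(n_1,n_2)=g(n_1+1,n_2+1)$, and similarly for repeated shifts; $\Delta_i g=g_{(i)}-g$. A (two-dimensional) quadrilateral lattice in $\mathbb{P}^M=\mathbb{P}(\mathbb{R}^{M+1})$ is a map $\mathbb{Z}^2\to\mathbb{P}^M$ with planar elementary quadrilaterals; in homogeneous coordinates $\mathbf{x}$ it satisfies a Laplace equation $\mathbf{x}_{(12)}=A_{(1)}\mathbf{x}_{(1)}+B_{(2)}\mathbf{x}_{(2)}+C\mathbf{x}$ with functions $A,B,C$ on $\mathbb{Z}^2$. Its Laplace transforms are $\mathbf{x}_1=\mathbf{x}_{(2)}-A\mathbf{x}$ and $\mathbf{x}_{-1}=\mathbf{x}_{(1)}-B\mathbf{x}$. A Koenigs lattice is a quadrilateral lattice such that for every point of it the six points $\mathbf{x}_1,\mathbf{x}_{1(1)},\mathbf{x}_{1(11)},\mathbf{x}_{-1},\mathbf{x}_{-1(2)},\mathbf{x}_{-1(22)}$ (which lie in the plane of the elementary quadrilateral $\mathbf{x},\mathbf{x}_{(1)},\mathbf{x}_{(2)},\mathbf{x}_{(12)}$) lie on a conic. Genericity convention: all lattices under consideration (both $\mathbf{x}$ and $\mathbf{x}'$) are assumed non-degenerate: at every point of $\mathbb{Z}^2$ the vectors $\mathbf{x},\mathbf{x}_{(1)},\mathbf{x}_{(2)}$ are linearly independent, $A,B,C$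 are nonzero, and $A_{(1)}B+C\neq0$, $B_{(2)}A+C\neq 0$. *)

theory Defs
  imports "HOL-Analysis.Analysis"
begin

definition shift1 :: "(int \<Rightarrow> int \<Rightarrow> 'a) \<Rightarrow> int \<Rightarrow> int \<Rightarrow> 'a" where
  "shift1 g = (\<lambda>i j. g (i + 1) j)"

definition shift2 :: "(int \<Rightarrow> int \<Rightarrow> 'a) \<Rightarrow> int \<Rightarrow> int \<Rightarrow> 'a" where
  "shift2 g = (\<lambda>i j. g i (j + 1))"

definition diff1 :: "(int \<Rightarrow> int \<Rightarrow> 'a::minus) \<Rightarrow> int \<Rightarrow> int \<Rightarrow> 'a" where
  "diff1 g = (\<lambda>i j. shift1 g i j - g i j)"

definition diff2 :: "(int \<Rightarrow> int \<Rightarrow> 'a::minus) \<Rightarrow> int \<Rightarrow> int \<Rightarrow> 'a" where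
  "diff2 g = (\<lambda>i j. shift2 g i j - g i j)"

(* A lattice in a real projective space is given by homogeneous coordinates: the
   value x i j is a nonzero representative of the projective point.  A linear
   subspace of vector space dimension 3 is a projective plane, so the four vertices
   of an elementary quadrilateral are coplanar iff their span has dimension \<le> 3. *)

definition quadrilateral :: "(int \<Rightarrow> int \<Rightarrow> 'a) \<Rightarrow> int \<Rightarrow> int \<Rightarrow> 'a set" where
  "quadrilateral x i j = {x i j, shift1 x i j, shift2 x i j, shift1 (shift2 x) i j}"

definition quadrilateral_lattice :: "(int \<Rightarrow> int \<Rightarrow> 'a::euclidean_space) \<Rightarrow> bool" where
  "quadrilateral_lattice x \<longleftrightarrow>
     (\<forall>i j. x i j \<noteq> 0) \<and> (\<forall>i j. dim (quadrilateral x i j) \<le> 3)"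

definition laplace_equation ::
  "(int \<Rightarrow> int \<Rightarrow> 'a::real_vector) \<Rightarrow> (int \<Rightarrow> int \<Rightarrow> real) \<Rightarrow> (int \<Rightarrow> int \<Rightarrow> real)
     \<Rightarrow> (int \<Rightarrow> int \<Rightarrow> real) \<Rightarrow> bool" where
  "laplace_equation x A B C \<longleftrightarrow>
     (\<forall>i j. shift1 (shift2 x) i j =
        shift1 A i j *\<^sub>R shift1 x i j + shift2 B i j *\<^sub>R shift2 x i j + C i j *\<^sub>R x i j)"

(* laplace_plus x A and laplace_minus x B are the Laplace transforms x_1 and x_{-1}. *)

definition laplace_plus ::
  "(int \<Rightarrow> int \<Rightarrow> 'a::real_vector) \<Rightarrow> (int \<Rightarrow> int \<Rightarrow> real) \<Rightarrow> int \<Rightarrow> int \<Rightarrow> 'a" where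
  "laplace_plus x A = (\<lambda>i j. shift2 x i j - A i j *\<^sub>R x i j)"

definition laplace_minus ::
  "(int \<Rightarrow> int \<Rightarrow> 'a::real_vector) \<Rightarrow> (int \<Rightarrow> int \<Rightarrow> real) \<Rightarrow> int \<Rightarrow> int \<Rightarrow> 'a" where
  "laplace_minus x B = (\<lambda>i j. shift1 x i j - B i j *\<^sub>R x i j)"

(* A conic in the projective plane P(W) is the zero locus of a quadratic form
   w \<mapsto> b w w that is not identically zero on W; degenerate conics are allowed.
   Every quadratic form on W extends to the whole space, so the bilinear form b may
   be taken on the ambient space. *)

definition lie_on_conic :: "'a::euclidean_space set \<Rightarrow> 'a set \<Rightarrow> bool" where
  "lie_on_conic W P \<longleftrightarrow>
     subspace W \<and> dim W = 3 \<and> P \<subseteq> W \<and>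
     (\<exists>b :: 'a \<Rightarrow> 'a \<Rightarrow> real. bilinear b \<and> (\<exists>w\<in>W. b w w \<noteq> 0) \<and> (\<forall>p\<in>P. b p p = 0))"

(* For non-degenerate lattices (see below) the functions A, B, C are uniquely
   determined by x, so the existential quantifier involves no choice. *)

definition koenigs_lattice :: "(int \<Rightarrow> int \<Rightarrow> 'a::euclidean_space) \<Rightarrow> bool" where
  "koenigs_lattice x \<longleftrightarrow>
     quadrilateral_lattice x \<and>
     (\<exists>A B C. laplace_equation x A B C \<and>
        (let xp = laplace_plus x A; xm = laplace_minus x B in
         \<forall>i j. lie_on_conic (span (quadrilateral x i j))
           {xp i j, shift1 xp i j, shift1 (shift1 xp) i j,
            xm i j, shift2 xm i j, shift2 (shift2 xm) i j}))"

(* The genericity convention.  It is a condition on x alone: once x, x_(1), x_(2) are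
   linearly independent there is at most one triple A, B, C of coefficients. *)

definition nondegenerate_lattice :: "(int \<Rightarrow> int \<Rightarrow> 'a::real_vector) \<Rightarrow> bool" where
  "nondegenerate_lattice x \<longleftrightarrow>
     (\<forall>i j. distinct [x i j, shift1 x i j, shift2 x i j] \<and>
        independent {x i j, shift1 x i j, shift2 x i j}) \<and>
     (\<forall>A B C. laplace_equation x A B C \<longrightarrow>
        (\<forall>i j. A i j \<noteq> 0 \<and> B i j \<noteq> 0 \<and> C i j \<noteq> 0 \<and>
           shift1 A i j * B i j + C i j \<noteq> 0 \<and> shift2 B i j * A i j + C i j \<noteq> 0))"

definition koenigs_system ::
  "(int \<Rightarrow> int \<Rightarrow> real) \<Rightarrow> (int \<Rightarrow> int \<Rightarrow> real) \<Rightarrow> (int \<Rightarrow> int \<Rightarrow> real)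
     \<Rightarrow> (int \<Rightarrow> int \<Rightarrow> 'a::real_vector) \<Rightarrow> (int \<Rightarrow> int \<Rightarrow> 'a) \<Rightarrow> bool" where
  "koenigs_system \<theta> \<phi> \<phi>' x x' \<longleftrightarrow>
     (\<forall>i j. diff1 (\<lambda>i j. x' i j /\<^sub>R \<phi>' i j) i j =
        shift1 (\<lambda>i j. \<theta> i j * shift2 \<theta> i j) i j *\<^sub>R diff1 (\<lambda>i j. x i j /\<^sub>R \<phi> i j) i j) \<and>
     (\<forall>i j. diff2 (\<lambda>i j. x' i j /\<^sub>R \<phi>' i j) i j =
        - (shift2 (\<lambda>i j. \<theta> i j * shift1 \<theta> i j) i j *\<^sub>R diff2 (\<lambda>i j. x i j /\<^sub>R \<phi> i j) i j))"

end

theory Submission imports Defs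
begin

text \<open>
  For a Laplace equation with coefficients $A = B = F$ and $C = -1$ the Koenigs condition is
  automatic: in the basis $x, x_{(1)}, x_{(2)}$ the lines spanned by the first two points of each
  triple fix the conic up to the coefficient of the product of the last two coordinates, and the
  two remaining incidences impose the same condition on that coefficient.  Hence it suffices to
  derive the equation for $x'$.  Both this equation and the compatibility of the linear system
  follow from $y = x / \phi$ satisfying
  $\phi_{(12)} y_{(12)} + \phi y = F_{(1)} \phi_{(1)} y_{(1)} + F_{(2)} \phi_{(2)} y_{(2)}$
  and from $F \phi = \theta_{(12)} + \theta$,
  $F' \phi' = 1 / \theta_{(12)} + 1 / \theta$.
\<close>

text \<open>Here \<open>u\<close>, \<open>v\<close>, \<open>w\<close>, \<open>z\<close> are the
  vertices x, x_(1), x_(2), x_(12) and \<open>F\<close>, \<open>F1\<close>, \<open>F2\<close>,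
  \<open>K\<close> are F, F_(1), F_(2), F_(12). The twice shifted Laplace transforms take the forms
  \<open>K *\<^sub>R z - v\<close> and \<open>K *\<^sub>R z - w\<close> through the equations of the
  neighbouring quadrilaterals.\<close>

lemma six_points_on_conic:
  fixes u v w :: "'a::euclidean_space" and F F1 F2 K :: real
  assumes dist: "distinct [u, v, w]" and ind: "independent {u, v, w}"
    and nz: "F1 \<noteq> 0" "F2 \<noteq> 0" "K \<noteq> 0"
    and z: "z = F1 *\<^sub>R v + F2 *\<^sub>R w - u"
  shows "lie_on_conic (span {u, v, w, z})
    {w - F *\<^sub>R u, z - F1 *\<^sub>R v, K *\<^sub>R z - v, v - F *\<^sub>R u, z - F2 *\<^sub>R w, K *\<^sub>R z - w}"
proof -
  have "z \<in> span {u, v, w}"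
    unfolding z by (intro span_diff span_add span_scale span_base) auto
  then have "span (insert z {u, v, w}) = span {u, v, w}"
    by (rule span_redundant)
  then have span: "span {u, v, w, z} = span {u, v, w}"
    by (simp add: insert_commute)
  have dim: "dim (span {u, v, w}) = 3"
    using dist dim_eq_card_independent[OF ind] by simp
  obtain a :: "'a \<Rightarrow> real" where a: "linear a" "a u = 1" "a v = 0" "a w = 0"
    using linear_independent_extend[OF ind, of "\<lambda>p. if p = u then 1 else 0"] dist by auto
  obtain b :: "'a \<Rightarrow> real" where b: "linear b" "b u = 0" "b v = 1" "b w = 0"
    using linear_independent_extend[OF ind, of "\<lambda>p. if p = v then 1 else 0"] dist by auto
  obtain c :: "'a \<Rightarrow> real" where c: "linear c" "c u = 0" "c v = 0" "c w = 1"
    using linear_independent_extend[OF ind, of "\<lambda>p. if p = w then 1 else 0"] dist by auto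
  note lin = linear_add[OF a(1)] linear_add[OF b(1)] linear_add[OF c(1)]
    linear_diff[OF a(1)] linear_diff[OF b(1)] linear_diff[OF c(1)]
    linear_scale[OF a(1)] linear_scale[OF b(1)] linear_scale[OF c(1)]
  \<comment> \<open>On c = 0 the form is K F2 (F1 a + b)(a + F b), on b = 0 it is K F1 (F2 a + c)(a
    + F c); these factors vanish at the four points on the two lines. At
    \<open>K *\<^sub>R z - v\<close> the remaining terms sum to -(F + K) b c, and likewise at
    \<open>K *\<^sub>R z - w\<close>, which dictates the last coefficient. The overall factor
    \<open>K\<close> avoids a division.\<close>
  define Q where "Q p q = K * (F1 * F2 * a p * a q + F * F2 * b p * b q + F * F1 * c p * c q
      + F2 * (1 + F * F1) * a p * b q + F1 * (1 + F * F2) * a p * c q) + (F + K) * b p * c q" for p q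
  have "bilinear Q"
    unfolding bilinear_def Q_def
    by (auto intro!: linearI simp: lin algebra_simps)
  moreover have "Q u u \<noteq> 0"
    using nz by (simp add: Q_def a b c)
  moreover have "Q p p = 0"
    if "p \<in> {w - F *\<^sub>R u, z - F1 *\<^sub>R v, K *\<^sub>R z - v, v - F *\<^sub>R u, z - F2 *\<^sub>R w, K *\<^sub>R z - w}" for p
    using that
    by (elim insertE emptyE) (simp_all only: Q_def z lin a b c, simp_all add: algebra_simps)
  moreover have "{w - F *\<^sub>R u, z - F1 *\<^sub>R v, K *\<^sub>R z - v, v - F *\<^sub>R u, z - F2 *\<^sub>R w, K *\<^sub>R z - w}
      \<subseteq> span {u, v, w, z}"
    by (auto intro!: span_diff span_scale intro: span_base)
  ultimately show ?thesis
    unfolding lie_on_conic_def using dim span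
    by (auto intro!: exI[of _ Q] bexI[of _ u] intro: span_base)
qed

lemma koenigs_lattice_if_symmetric_laplace:
  fixes x :: "int \<Rightarrow> int \<Rightarrow> 'a::euclidean_space" and F :: "int \<Rightarrow> int \<Rightarrow> real"
  assumes nondeg: "nondegenerate_lattice x"
    and eq: "\<And>i j. x (i + 1) (j + 1) + x i j
      = F (i + 1) j *\<^sub>R x (i + 1) j + F i (j + 1) *\<^sub>R x i (j + 1)"
  shows "koenigs_lattice x"
proof -
  have z: "x (i + 1) (j + 1)
      = F (i + 1) j *\<^sub>R x (i + 1) j + F i (j + 1) *\<^sub>R x i (j + 1) - x i j" for i j
    using eq[of i j] by (simp add: algebra_simps)
  have laplace: "laplace_equation x F F (\<lambda>i j. - 1)"
    by (simp add: laplace_equation_def shift1_def shift2_def z)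
  \<comment> \<open>Nondegeneracy constrains every triple of coefficients of \<open>x\<close>, in
    particular the triple \<open>F\<close>, \<open>F\<close>, -1.\<close>
  then have F: "F i j \<noteq> 0" for i j
    using nondeg unfolding nondegenerate_lattice_def by blast
  have dist: "distinct [x i j, x (i + 1) j, x i (j + 1)]"
    and ind: "independent {x i j, x (i + 1) j, x i (j + 1)}" for i j
    using nondeg by (simp_all add: nondegenerate_lattice_def shift1_def shift2_def)
  have quad: "quadrilateral x i j = {x i j, x (i + 1) j, x i (j + 1), x (i + 1) (j + 1)}" for i j
    by (simp add: quadrilateral_def shift1_def shift2_def)
  have conic: "lie_on_conic (span (quadrilateral x i j))
      {laplace_plus x F i j, shift1 (laplace_plus x F) i j,
       shift1 (shift1 (laplace_plus x F)) i j,
       laplace_minus x F i j, shift2 (laplace_minus x F) i j,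
       shift2 (shift2 (laplace_minus x F)) i j}" for i j
  proof -
    \<comment> \<open>The equations based at (i + 1, j) and (i, j + 1) express the twice shifted
      transforms through vertices of the quadrilateral at (i, j).\<close>
    have "x (i + 1 + 1) (j + 1) - F (i + 1 + 1) j *\<^sub>R x (i + 1 + 1) j
        = F (i + 1) (j + 1) *\<^sub>R x (i + 1) (j + 1) - x (i + 1) j"
      and "x (i + 1) (j + 1 + 1) - F i (j + 1 + 1) *\<^sub>R x i (j + 1 + 1)
        = F (i + 1) (j + 1) *\<^sub>R x (i + 1) (j + 1) - x i (j + 1)"
      using eq[of "i + 1" j] eq[of i "j + 1"] by (simp_all add: algebra_simps)
    then show ?thesis
      using six_points_on_conic[OF dist ind F F F z, of i j "F i j" "i + 1" "j + 1"]
      unfolding quad laplace_plus_def laplace_minus_def shift1_def shift2_def by simp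
  qed
  have "x i j \<noteq> 0" for i j
    using ind[of i j] dependent_zero[of "{x i j, x (i + 1) j, x i (j + 1)}"] by auto
  moreover have "dim (quadrilateral x i j) \<le> 3" for i j
    using conic[of i j] by (simp add: lie_on_conic_def)
  ultimately show ?thesis
    unfolding koenigs_lattice_def quadrilateral_lattice_def
    using laplace conic by (auto simp: Let_def)
qed

lemma int_diff_eq_imp_eq:
  fixes f g :: "int \<Rightarrow> 'a::ab_group_add"
  assumes diff: "\<And>i. f (i + 1) - f i = g (i + 1) - g i" and zero: "f 0 = g 0"
  shows "f i = g i"
proof (induction i rule: int_induct[where k = 0])
  case base
  show ?case by (rule zero)
next
  case (step1 i)
  then show ?case using diff[of i] by simp
next
  case (step2 i)
  then show ?case using diff[of "i - 1"] by simp
qed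

lemma int_antidifference:
  fixes f :: "int \<Rightarrow> 'a::ab_group_add"
  shows "\<exists>g. g 0 = 0 \<and> (\<forall>i. g (i + 1) - g i = f i)"
proof -
  \<comment> \<open>A sum from 0 to \<open>i\<close> with orientation: for negative \<open>i\<close>
    it runs backwards with the opposite sign. The case \<open>i = - 1\<close> below is the step
    joining the two branches.\<close>
  define g where "g i = (if 0 \<le> i then sum f {0..<i} else - sum f {i..<0})" for i
  have "g (i + 1) - g i = f i" for i
  proof -
    consider "0 \<le> i" | "i = - 1" | "i < - 1" by linarith
    then show ?thesis
    proof cases
      case 1
      then have "{0..<i + 1} = insert i {0..<i}" by auto
      with 1 show ?thesis by (simp add: g_def)
    next
      case 2
      then have "{i..<0} = {i}" by auto
      with 2 show ?thesis by (simp add: g_def)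
    next
      case 3
      then have "{i..<0} = insert i {i + 1..<0}" by auto
      with 3 show ?thesis by (simp add: g_def)
    qed
  qed
  moreover have "g 0 = 0" by (simp add: g_def)
  ultimately show ?thesis by blast
qed

text \<open>A discrete Poincare lemma: sum \<open>p\<close> along the axis j = 0, then
  \<open>q\<close> along each column. Compatibility carries the first equation from the axis to all
  rows. For uniqueness the value at the origin propagates along the same paths.\<close>

lemma ex1_lattice_potential:
  fixes p q :: "int \<Rightarrow> int \<Rightarrow> 'a::ab_group_add"
  assumes compat: "\<And>i j. p i (j + 1) - p i j = q (i + 1) j - q i j"
  shows "\<exists>!y. (\<forall>i j. diff1 y i j = p i j) \<and> (\<forall>i j. diff2 y i j = q i j) \<and> y 0 0 = v"
proof (rule ex_ex1I)
  obtain g where g: "g 0 = 0" "\<And>i. g (i + 1) - g i = p i 0"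
    using int_antidifference[of "\<lambda>i. p i 0"] by blast
  have "\<forall>i. \<exists>h. h 0 = 0 \<and> (\<forall>j. h (j + 1) - h j = q i j)"
    by (blast intro: int_antidifference)
  then obtain h where h: "\<And>i. h i 0 = 0" "\<And>i j. h i (j + 1) - h i j = q i j"
    by metis
  \<comment> \<open>Both sides vanish at j = 0 and, by \<open>compat\<close>, have the same
    differences in j.\<close>
  have h_diff: "h (i + 1) j - h i j = p i j - p i 0" for i j
  proof (rule int_diff_eq_imp_eq[where i = j])
    show "h (i + 1) (k + 1) - h i (k + 1) - (h (i + 1) k - h i k)
        = p i (k + 1) - p i 0 - (p i k - p i 0)" for k
      using compat[of i k] h(2)[of "i + 1" k] h(2)[of i k] by (simp add: algebra_simps)
  qed (simp add: h)
  have "v + g (i + 1) + h (i + 1) j - (v + g i + h i j) = p i j" for i j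
    using g(2)[of i] h_diff[of i j] by (simp add: algebra_simps)
  then show "\<exists>y. (\<forall>i j. diff1 y i j = p i j) \<and> (\<forall>i j. diff2 y i j = q i j) \<and> y 0 0 = v"
    by (intro exI[of _ "\<lambda>i j. v + g i + h i j"])
      (simp add: diff1_def diff2_def shift1_def shift2_def g h)
next
  fix y y'
  assume y: "(\<forall>i j. diff1 y i j = p i j) \<and> (\<forall>i j. diff2 y i j = q i j) \<and> y 0 0 = v"
    and y': "(\<forall>i j. diff1 y' i j = p i j) \<and> (\<forall>i j. diff2 y' i j = q i j) \<and> y' 0 0 = v"
  have zero: "y i 0 = y' i 0" for i
    by (rule int_diff_eq_imp_eq[of "\<lambda>i. y i 0" "\<lambda>i. y' i 0"])
      (use y y' in \<open>simp_all add: diff1_def shift1_def\<close>)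
  have "y i j = y' i j" for i j
    by (rule int_diff_eq_imp_eq[of "y i" "y' i"])
      (use y y' zero in \<open>simp_all add: diff2_def shift2_def\<close>)
  then show "y = y'" by blast
qed

lemma koenigs_system_iff:
  "koenigs_system \<theta> \<phi> \<phi>' x x' \<longleftrightarrow>
    (\<forall>i j. diff1 (\<lambda>i j. x' i j /\<^sub>R \<phi>' i j) i j = (\<theta> (i + 1) j * \<theta> (i + 1) (j + 1)) *\<^sub>R
       (x (i + 1) j /\<^sub>R \<phi> (i + 1) j - x i j /\<^sub>R \<phi> i j)) \<and>
    (\<forall>i j. diff2 (\<lambda>i j. x' i j /\<^sub>R \<phi>' i j) i j = - ((\<theta> i (j + 1) * \<theta> (i + 1) (j + 1)) *\<^sub>R
       (x i (j + 1) /\<^sub>R \<phi> i (j + 1) - x i j /\<^sub>R \<phi> i j)))"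
  by (simp add: koenigs_system_def diff1_def diff2_def shift1_def shift2_def)

text \<open>A solution of the linear system is fixed by its value at the origin, so "the solution"
  means unique existence for each such value; the conclusions on x' cover every solution obeying the
  genericity convention.\<close>

theorem proposition3p6:
  fixes M :: nat
    and x :: "int \<Rightarrow> int \<Rightarrow> real ^ 'm"
    and F F' \<theta> \<phi> \<phi>' :: "int \<Rightarrow> int \<Rightarrow> real"
  assumes "M \<ge> 2"
    and "CARD('m) = M + 1"
    and "koenigs_lattice x"
    and "nondegenerate_lattice x"
    and "\<forall>i j. shift1 (shift2 x) i j + x i j =
           shift1 F i j *\<^sub>R shift1 x i j + shift2 F i j *\<^sub>R shift2 x i j"
    and "\<forall>i j. shift1 (shift2 \<theta>) i j + \<theta> i j = F i j * (shift1 \<theta> i j + shift2 \<theta> i j)"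
    and "\<forall>i j. \<phi> i j = shift1 \<theta> i j + shift2 \<theta> i j"
    and "\<forall>i j. \<phi>' i j = 1 / shift1 \<theta> i j + 1 / shift2 \<theta> i j"
    and "\<forall>i j. F' i j =
           F i j * (shift1 \<theta> i j * shift2 \<theta> i j / (\<theta> i j * shift1 (shift2 \<theta>) i j))"
    and "\<forall>i j. \<theta> i j \<noteq> 0"
    and "\<forall>i j. \<phi> i j \<noteq> 0"
  shows "(\<forall>v. \<exists>!x'. koenigs_system \<theta> \<phi> \<phi>' x x' \<and> x' 0 0 = v) \<and>
    (\<forall>x'. koenigs_system \<theta> \<phi> \<phi>' x x' \<and> nondegenerate_lattice x' \<longrightarrow>
       koenigs_lattice x' \<and>
       (\<forall>i j. shift1 (shift2 x') i j + x' i j =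
          shift1 F' i j *\<^sub>R shift1 x' i j + shift2 F' i j *\<^sub>R shift2 x' i j))"
proof -
  have x_eq: "x (i + 1) (j + 1)
      = F (i + 1) j *\<^sub>R x (i + 1) j + F i (j + 1) *\<^sub>R x i (j + 1) - x i j" for i j
    using assms(5) by (simp add: shift1_def shift2_def eq_diff_eq)
  have \<theta>_eq: "\<theta> (i + 1) (j + 1) + \<theta> i j = F i j * \<phi> i j" for i j
    using assms(6,7) by (simp add: shift1_def shift2_def)
  have \<phi>: "\<phi> i j = \<theta> (i + 1) j + \<theta> i (j + 1)" for i j
    using assms(7) by (simp add: shift1_def shift2_def)
  have \<theta>: "\<theta> i j \<noteq> 0" and \<phi>_nz: "\<phi> i j \<noteq> 0" for i j
    using assms(10,11) by auto
  have \<phi>': "\<phi>' i j = 1 / \<theta> (i + 1) j + 1 / \<theta> i (j + 1)" for i j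
    using assms(8) by (simp add: shift1_def shift2_def)
  have \<phi>'_alt: "\<phi>' i j = \<phi> i j / (\<theta> (i + 1) j * \<theta> i (j + 1))" for i j
    by (simp add: \<phi>' \<phi> \<theta> field_simps)
  have \<phi>'_nz: "\<phi>' i j \<noteq> 0" for i j
    by (simp add: \<phi>'_alt \<phi>_nz \<theta>)
  \<comment> \<open>This is the Moutard equation for 1/\<theta> with potential \<open>F'\<close>,
    the counterpart of \<open>\<theta>_eq\<close>.\<close>
  have F'\<phi>': "F' i j * \<phi>' i j = 1 / \<theta> i j + 1 / \<theta> (i + 1) (j + 1)" for i j
  proof -
    have "F' i j * \<phi>' i j = F i j * \<phi> i j / (\<theta> i j * \<theta> (i + 1) (j + 1))"
      using assms(9) by (simp add: \<phi>'_alt \<theta> shift1_def shift2_def)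
    then show ?thesis
      by (simp add: \<theta>_eq[symmetric] \<theta> field_simps)
  qed

  define y where "y i j = x i j /\<^sub>R \<phi> i j" for i j
  define p where "p i j = (\<theta> (i + 1) j * \<theta> (i + 1) (j + 1)) *\<^sub>R (y (i + 1) j - y i j)" for i j
  define q where "q i j = - ((\<theta> i (j + 1) * \<theta> (i + 1) (j + 1)) *\<^sub>R (y i (j + 1) - y i j))" for i j
  have x: "x i j = \<phi> i j *\<^sub>R y i j" for i j
    by (simp add: y_def \<phi>_nz)
  \<comment> \<open>The Moutard equation at the two shifted points trades F_(1) \<phi>_(1) and F_(2)
    \<phi>_(2) for sums of values of \<theta>, eliminating \<open>F\<close>.\<close>
  have y_eq: "\<phi> (i + 1) (j + 1) *\<^sub>R y (i + 1) (j + 1)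
      = (\<theta> (i + 1 + 1) (j + 1) + \<theta> (i + 1) j) *\<^sub>R y (i + 1) j
        + (\<theta> (i + 1) (j + 1 + 1) + \<theta> i (j + 1)) *\<^sub>R y i (j + 1) - \<phi> i j *\<^sub>R y i j" for i j
    using x_eq[of i j] unfolding \<theta>_eq by (simp add: x)
  have compat: "p i (j + 1) - p i j = q (i + 1) j - q i j" for i j
  proof -
    \<comment> \<open>All four terms share the factor \<theta>_(12); the cofactor is the residual of
      \<open>y_eq\<close>.\<close>
    have "p i (j + 1) - p i j - (q (i + 1) j - q i j)
        = \<theta> (i + 1) (j + 1) *\<^sub>R (\<phi> (i + 1) (j + 1) *\<^sub>R y (i + 1) (j + 1)
          - (\<theta> (i + 1 + 1) (j + 1) + \<theta> (i + 1) j) *\<^sub>R y (i + 1) j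
          - (\<theta> (i + 1) (j + 1 + 1) + \<theta> i (j + 1)) *\<^sub>R y i (j + 1) + \<phi> i j *\<^sub>R y i j)"
      by (simp add: p_def q_def \<phi> algebra_simps)
    also have "\<dots> = 0"
      by (simp add: y_eq)
    finally show ?thesis by simp
  qed
  have system: "koenigs_system \<theta> \<phi> \<phi>' x x' \<longleftrightarrow>
      (\<forall>i j. diff1 (\<lambda>i j. x' i j /\<^sub>R \<phi>' i j) i j = p i j) \<and>
      (\<forall>i j. diff2 (\<lambda>i j. x' i j /\<^sub>R \<phi>' i j) i j = q i j)" for x'
    by (simp add: koenigs_system_iff p_def q_def y_def)

  have ex1: "\<exists>!x'. koenigs_system \<theta> \<phi> \<phi>' x x' \<and> x' 0 0 = v" for v
  proof -
    let ?P = "\<lambda>y'. (\<forall>i j. diff1 y' i j = p i j) \<and> (\<forall>i j. diff2 y' i j = q i j)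
      \<and> y' 0 0 = v /\<^sub>R \<phi>' 0 0"
    \<comment> \<open>As \<phi>' vanishes nowhere, x' and x'/\<phi>' determine each other, so unique
      existence transfers from the potential.\<close>
    have iff: "koenigs_system \<theta> \<phi> \<phi>' x x' \<and> x' 0 0 = v
        \<longleftrightarrow> ?P (\<lambda>i j. x' i j /\<^sub>R \<phi>' i j)" for x'
      by (simp add: system \<phi>'_nz)
    have ex1: "\<exists>!y'. ?P y'"
      by (rule ex1_lattice_potential) (rule compat)
    then obtain y' where y': "?P y'" by blast
    show ?thesis
    proof (rule ex1I)
      show "koenigs_system \<theta> \<phi> \<phi>' x (\<lambda>i j. \<phi>' i j *\<^sub>R y' i j)
          \<and> \<phi>' 0 0 *\<^sub>R y' 0 0 = v"
        using iff[of "\<lambda>i j. \<phi>' i j *\<^sub>R y' i j"] y' by (simp add: \<phi>'_nz)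
    next
      fix x'
      assume "koenigs_system \<theta> \<phi> \<phi>' x x' \<and> x' 0 0 = v"
      then have "?P (\<lambda>i j. x' i j /\<^sub>R \<phi>' i j)" unfolding iff .
      with ex1 y' have "(\<lambda>i j. x' i j /\<^sub>R \<phi>' i j) = y'" by blast
      then show "x' = (\<lambda>i j. \<phi>' i j *\<^sub>R y' i j)"
        by (auto simp: \<phi>'_nz)
    qed
  qed

  have x'_eq: "x' (i + 1) (j + 1) + x' i j
      = F' (i + 1) j *\<^sub>R x' (i + 1) j + F' i (j + 1) *\<^sub>R x' i (j + 1)"
    if "koenigs_system \<theta> \<phi> \<phi>' x x'" for x' i j
  proof -
    define y' where "y' i j = x' i j /\<^sub>R \<phi>' i j" for i j
    have x': "x' i j = \<phi>' i j *\<^sub>R y' i j" for i j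
      by (simp add: y'_def \<phi>'_nz)
    have y'1: "y' (i + 1) j = p i j + y' i j" and y'2: "y' i (j + 1) = q i j + y' i j" for i j
      using that unfolding system
      by (simp_all add: y'_def diff1_def diff2_def shift1_def shift2_def diff_eq_eq)
    let ?t1 = "\<theta> (i + 1) j" and ?t2 = "\<theta> i (j + 1)" and ?t12 = "\<theta> (i + 1) (j + 1)"
      and ?t112 = "\<theta> (i + 1 + 1) (j + 1)" and ?t122 = "\<theta> (i + 1) (j + 1 + 1)"
    have y12: "(?t112 + ?t122) *\<^sub>R y (i + 1) (j + 1)
        = (?t112 + ?t1) *\<^sub>R y (i + 1) j + (?t122 + ?t2) *\<^sub>R y i (j + 1) - (?t1 + ?t2) *\<^sub>R y i j"
      using y_eq[of i j] by (simp add: \<phi>)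
    \<comment> \<open>With x' = \<phi>' y', both sides of the desired equation contain
      \<open>y' i j\<close> with total coefficient 1/\<theta>_(1) + 1/\<theta>_(2) +
      1/\<theta>_(112) + 1/\<theta>_(122). What remains is this identity between increments, x'_(12)
      being reached via x'_(1).\<close>
    have key: "(1 / ?t112 + 1 / ?t122) *\<^sub>R (p i j + q (i + 1) j)
        = (1 / ?t1 + 1 / ?t112) *\<^sub>R p i j + (1 / ?t2 + 1 / ?t122) *\<^sub>R q i j"
    proof -
      let ?d1 = "y (i + 1) j - y i j" and ?d2 = "y i (j + 1) - y i j"
        and ?d12 = "y (i + 1) (j + 1) - y (i + 1) j"
      let ?e = "?t1 *\<^sub>R ?d1 - ?t112 *\<^sub>R ?d12" and ?c = "?t12 / (?t112 * ?t122)"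
      \<comment> \<open>In \<open>y12\<close> the coefficients on both sides have equal sums, so it
        is a relation between differences of \<open>y\<close>; multiplying by \<theta>_(112) lets it
        eliminate \<open>?d12\<close>.\<close>
      have e: "(?t112 + ?t122) *\<^sub>R ?e
          = (?t122 * (?t112 + ?t1)) *\<^sub>R ?d1 - (?t112 * (?t122 + ?t2)) *\<^sub>R ?d2"
        using arg_cong[OF y12, of "scaleR ?t112"] by (simp add: algebra_simps)
      have coeff: "(1 / ?t112 + 1 / ?t122) * ?t12 = ?c * (?t112 + ?t122)"
        "?c * (?t122 * (?t112 + ?t1)) = (1 / ?t1 + 1 / ?t112) * (?t1 * ?t12)"
        "?c * (?t112 * (?t122 + ?t2)) = (1 / ?t2 + 1 / ?t122) * (?t2 * ?t12)"
        by (simp_all add: \<theta> field_simps)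
      have "p i j + q (i + 1) j = ?t12 *\<^sub>R ?e"
        by (simp add: p_def q_def algebra_simps)
      then have "(1 / ?t112 + 1 / ?t122) *\<^sub>R (p i j + q (i + 1) j)
          = (?c * (?t112 + ?t122)) *\<^sub>R ?e"
        by (simp only: coeff(1) scaleR_scaleR)
      also have "\<dots> = ?c *\<^sub>R ((?t112 + ?t122) *\<^sub>R ?e)"
        by (simp only: scaleR_scaleR)
      also have "\<dots> = (1 / ?t1 + 1 / ?t112) *\<^sub>R p i j + (1 / ?t2 + 1 / ?t122) *\<^sub>R q i j"
        by (simp only: e scaleR_diff_right[of ?c] scaleR_scaleR coeff(2,3) p_def q_def
            scaleR_minus_right add_uminus_conv_diff)
      finally show ?thesis .
    qed
    have y'12: "y' (i + 1) (j + 1) = (p i j + q (i + 1) j) + y' i j"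
      by (simp only: y'2[of "i + 1" j] y'1[of i j]) (simp only: ac_simps)
    have "x' (i + 1) (j + 1) + x' i j
        = (1 / ?t112 + 1 / ?t122) *\<^sub>R (p i j + q (i + 1) j)
          + (1 / ?t112 + 1 / ?t122) *\<^sub>R y' i j + (1 / ?t1 + 1 / ?t2) *\<^sub>R y' i j"
      by (simp only: x' \<phi>' y'12 scaleR_add_right)
    also have "\<dots> = (1 / ?t1 + 1 / ?t112) *\<^sub>R (p i j + y' i j)
        + (1 / ?t2 + 1 / ?t122) *\<^sub>R (q i j + y' i j)"
      unfolding key by (simp add: algebra_simps)
    also have "\<dots> = F' (i + 1) j *\<^sub>R x' (i + 1) j + F' i (j + 1) *\<^sub>R x' i (j + 1)"
      by (simp only: x' scaleR_scaleR F'\<phi>' y'1 y'2)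
    finally show ?thesis .
  qed

  show ?thesis
    unfolding shift1_def shift2_def
  proof (intro conjI allI impI)
    show "\<exists>!x'. koenigs_system \<theta> \<phi> \<phi>' x x' \<and> x' 0 0 = v" for v
      by (rule ex1)
  next
    fix x'
    assume x': "koenigs_system \<theta> \<phi> \<phi>' x x' \<and> nondegenerate_lattice x'"
    note eq = x'_eq[OF conjunct1[OF x']]
    show "koenigs_lattice x'"
      by (rule koenigs_lattice_if_symmetric_laplace[of x' F', OF conjunct2[OF x'] eq])
    show "x' (i + 1) (j + 1) + x' i j
        = F' (i + 1) j *\<^sub>R x' (i + 1) j + F' i (j + 1) *\<^sub>R x' i (j + 1)" for i j
      by (rule eq)
  qed
qed

end
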